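(* Let $m\ge 2$, $n\ge 1$, and let $\vec{b},\vec{b}'\in (B_m)^n$. If $\vec{b}$ and $\vec{b}'$ are Hurwitz equivalent, then $P(\vec{b})=P(\vec{b}')$, where $P$ denotes the characteristic polynomial of a braid system.
   Context: $B_m$ ($m\ge 2$) is the $m$-strand braid group with standard generators $\sigma_1,\dots,\sigma_{m-1}$ and relations $\sigma_i\sigma_j\sigma_i=\sigma_j\sigma_i\sigma_j$ for $|i-j|=1$, $\sigma_i\sigma_j=\sigma_j\sigma_i$ for $|i-j|>1$. Braids are read from top to bottom, $bc$ meaning $b$ placed above $c$. The $k$-th strand of a braid (diagram) is the strand whose upper endpoint is at the $k$-th position from the left. The letter $\sigma_i$ is a positive crossing between the strands currently at positions $i$ and $i+1$, at which the strand at position $i$ passes over; $\sigma_i^{-1}$ is a negative crossing between the strands currently at positions $i$ and $i+1$, at which the strand at position $i+1$ passes over. The crossing matrix $C(b)$ of $b\in B_m$ is the $m\times m$ integer matrix with zero diagonal whose $(i,j)$-entry ($i\neq j$) is, for any diagram (word) of $b$, the number of positive crossings minus the number of negative crossings between the $i$-th and $j$-th strands at which the $i$-th strand passes over the $j$-th strand; it does not depend on the diagram. The braid permutation of $b$ is the permutation of $\{1,\dots,m\}$ sending $k$ to the bottom position of the $k$-th strand. If $r$ is the order of the braid permutation of $b$, the characteristic polynomial of $b$ is $P(b)=\det(xI-C(b^r))$, with $I$ the $m\times m$ identity matrix. A braid system of degree $m$ and length $n$ is an element $\vec{b}=(b_1,\dots,b_n)\in (B_m)^n$, and its characteristic polynomial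 is $P(\vec{b})=P(b_1)P(b_2)\cdots P(b_n)$. For a group $G$ and $g,h\in G$ put $g*h=h^{-1}gh$. The Hurwitz action is the right action of $B_n$ on $G^n$ given by $(g_1,\dots,g_n)\cdot\sigma_i=(g_1,\dots,g_{i-1},g_{i+1},g_i*g_{i+1},g_{i+2},\dots,g_n)$ and $(g_1,\dots,g_n)\cdot\sigma_i^{-1}=(g_1,\dots,g_{i-1},g_{i+1}*(g_i^{-1}),g_i,g_{i+2},\dots,g_n)$ for $1\le i\le n-1$ (for $n=1$ the action is trivial). Two elements of $G^n$ are Hurwitz equivalent if they lie in the same orbit; here $G=B_m$. *)

theory Defs
  imports "HOL-Algebra.Sym_Groups" "HOL-Algebra.Multiplicative_Group" "Jordan_Normal_Form.Char_Poly"
begin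

text \<open>\<open>Pos i\<close> and \<open>Neg i\<close> are the letters $\sigma_i$ and $\sigma_i^{-1}$. Positions and strands are
  numbered from 1, and the first letter of a word is the topmost crossing.\<close>

datatype braid_letter = Pos nat | Neg nat

type_synonym braid_word = "braid_letter list"

fun letter_index :: "braid_letter \<Rightarrow> nat" where
  "letter_index (Pos i) = i"
| "letter_index (Neg i) = i"

definition braid_words :: "nat \<Rightarrow> braid_word set" where
  "braid_words m = {w. \<forall>l\<in>set w. letter_index l \<in> {1..<m}}"

inductive braid_equiv :: "nat \<Rightarrow> braid_word \<Rightarrow> braid_word \<Rightarrow> bool" for m where
  refl: "w \<in> braid_words m \<Longrightarrow> braid_equiv m w w"
| sym: "braid_equiv m u v \<Longrightarrow> braid_equiv m v u"
| trans: "braid_equiv m u v \<Longrightarrow> braid_equiv m v w \<Longrightarrow> braid_equiv m u w"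
| append: "braid_equiv m u u' \<Longrightarrow> braid_equiv m v v' \<Longrightarrow> braid_equiv m (u @ v) (u' @ v')"
| Pos_Neg: "i \<in> {1..<m} \<Longrightarrow> braid_equiv m [Pos i, Neg i] []"
| Neg_Pos: "i \<in> {1..<m} \<Longrightarrow> braid_equiv m [Neg i, Pos i] []"
| braid: "i \<in> {1..<m} \<Longrightarrow> j \<in> {1..<m} \<Longrightarrow> \<bar>int i - int j\<bar> = 1 \<Longrightarrow>
    braid_equiv m [Pos i, Pos j, Pos i] [Pos j, Pos i, Pos j]"
| commute: "i \<in> {1..<m} \<Longrightarrow> j \<in> {1..<m} \<Longrightarrow> \<bar>int i - int j\<bar> > 1 \<Longrightarrow>
    braid_equiv m [Pos i, Pos j] [Pos j, Pos i]"

definition braid_rel :: "nat \<Rightarrow> (braid_word \<times> braid_word) set" where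
  "braid_rel m = {(u, v). braid_equiv m u v}"

type_synonym braid = "braid_word set"

definition braid_group :: "nat \<Rightarrow> braid monoid" where
  "braid_group m =
    \<lparr>carrier = braid_words m // braid_rel m,
     mult = (\<lambda>b c. \<Union>u\<in>b. \<Union>v\<in>c. braid_rel m `` {u @ v}),
     one = braid_rel m `` {[]}\<rparr>"

lemma braid_words_simps [simp]:
  "[] \<in> braid_words m"
  "l # w \<in> braid_words m \<longleftrightarrow> letter_index l \<in> {1..<m} \<and> w \<in> braid_words m"
  "u @ v \<in> braid_words m \<longleftrightarrow> u \<in> braid_words m \<and> v \<in> braid_words m"
  by (auto simp: braid_words_def)

lemma braid_equiv_words: "braid_equiv m u v \<Longrightarrow> u \<in> braid_words m \<and> v \<in> braid_words m"
  by (induction rule: braid_equiv.induct) auto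

lemma equiv_braid_rel: "equiv (braid_words m) (braid_rel m)"
proof (rule equivI)
  show "braid_rel m \<subseteq> braid_words m \<times> braid_words m"
    using braid_equiv_words by (auto simp: braid_rel_def)
  show "refl_on (braid_words m) (braid_rel m)"
    by (auto simp: refl_on_def braid_rel_def intro: braid_equiv.refl)
  show "sym (braid_rel m)"
    by (auto simp: sym_def braid_rel_def intro: braid_equiv.sym)
  show "trans (braid_rel m)"
    by (auto simp: trans_def braid_rel_def intro: braid_equiv.trans)
qed

lemma carrier_braid_groupE:
  assumes "b \<in> carrier (braid_group m)"
  obtains w where "w \<in> braid_words m" "b = braid_rel m `` {w}"
proof -
  have "b \<in> braid_words m // braid_rel m" using assms by (simp add: braid_group_def)
  then show thesis by (rule quotientE) (rule that)
qed

lemma braid_class_in_carrier: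
  "w \<in> braid_words m \<Longrightarrow> braid_rel m `` {w} \<in> carrier (braid_group m)"
  by (simp add: braid_group_def quotientI)

lemma braid_class_eqI: "braid_equiv m u v \<Longrightarrow> braid_rel m `` {u} = braid_rel m `` {v}"
  by (rule equiv_class_eq[OF equiv_braid_rel]) (simp add: braid_rel_def)

lemma mult_braid_class:
  assumes "u \<in> braid_words m" "v \<in> braid_words m"
  shows "braid_rel m `` {u} \<otimes>\<^bsub>braid_group m\<^esub> braid_rel m `` {v} = braid_rel m `` {u @ v}"
proof -
  define A B C where "A = braid_rel m `` {u}" and "B = braid_rel m `` {v}"
    and "C = braid_rel m `` {u @ v}"
  have const: "braid_rel m `` {u' @ v'} = C" if "u' \<in> A" "v' \<in> B" for u' v'
  proof -
    have "braid_equiv m u' u" "braid_equiv m v' v"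
      using that by (simp_all add: A_def B_def braid_rel_def braid_equiv.sym)
    then show ?thesis unfolding C_def by (intro braid_class_eqI braid_equiv.append)
  qed
  have "u \<in> A" "v \<in> B"
    using assms by (simp_all add: A_def B_def braid_rel_def braid_equiv.refl)
  then have "A \<noteq> {}" "B \<noteq> {}" by blast+
  have "(\<Union>u'\<in>A. \<Union>v'\<in>B. braid_rel m `` {u' @ v'}) = (\<Union>u'\<in>A. \<Union>v'\<in>B. C)"
    by (intro SUP_cong HOL.refl const)
  also have "\<dots> = C" using \<open>A \<noteq> {}\<close> \<open>B \<noteq> {}\<close> by simp
  finally show ?thesis by (simp add: braid_group_def A_def B_def C_def)
qed

lemma one_braid_group: "\<one>\<^bsub>braid_group m\<^esub> = braid_rel m `` {[]}"
  by (simp add: braid_group_def)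

lemma braid_word_left_inverse:
  "w \<in> braid_words m \<Longrightarrow> \<exists>v\<in>braid_words m. braid_equiv m (v @ w) []"
proof (induction w)
  case Nil
  show ?case by (rule bexI[of _ "[]"]) (auto intro: braid_equiv.refl)
next
  case (Cons l w)
  then obtain v where v: "v \<in> braid_words m" "braid_equiv m (v @ w) []" by auto
  obtain l' where l': "letter_index l' \<in> {1..<m}" "braid_equiv m [l', l] []"
  proof (cases l)
    case (Pos i)
    then show thesis using Cons.prems by (intro that[of "Neg i"]) (auto intro: braid_equiv.intros)
  next
    case (Neg i)
    then show thesis using Cons.prems by (intro that[of "Pos i"]) (auto intro: braid_equiv.intros)
  qed
  have w: "braid_equiv m w w" "braid_equiv m v v"
    using Cons.prems v by (auto intro: braid_equiv.refl)
  have "braid_equiv m (v @ ([l', l] @ w)) (v @ ([] @ w))"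
    by (intro braid_equiv.append w l')
  then have "braid_equiv m ((v @ [l']) @ l # w) []"
    using v(2) by (auto intro: braid_equiv.trans)
  then show ?case using v l' by (intro bexI[of _ "v @ [l']"]) auto
qed

lemma group_braid_group: "group (braid_group m)"
proof (rule groupI)
  show "\<one>\<^bsub>braid_group m\<^esub> \<in> carrier (braid_group m)"
    by (simp add: one_braid_group braid_class_in_carrier)
next
  fix b assume "b \<in> carrier (braid_group m)"
  then obtain w where w: "w \<in> braid_words m" "b = braid_rel m `` {w}"
    by (rule carrier_braid_groupE)
  then show "\<one>\<^bsub>braid_group m\<^esub> \<otimes>\<^bsub>braid_group m\<^esub> b = b"
    by (simp add: one_braid_group mult_braid_class)
  obtain v where "v \<in> braid_words m" "braid_equiv m (v @ w) []"
    using braid_word_left_inverse w by blast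
  then show "\<exists>c\<in>carrier (braid_group m). c \<otimes>\<^bsub>braid_group m\<^esub> b = \<one>\<^bsub>braid_group m\<^esub>"
    using w braid_class_eqI[of m "v @ w" "[]"]
    by (intro bexI[of _ "braid_rel m `` {v}"])
      (simp_all add: one_braid_group mult_braid_class braid_class_in_carrier)
qed (auto elim!: carrier_braid_groupE simp: mult_braid_class braid_class_in_carrier)

text \<open>The bottom position of the strand that starts at position \<open>k\<close>.\<close>

fun word_perm :: "braid_word \<Rightarrow> nat \<Rightarrow> nat" where
  "word_perm [] k = k"
| "word_perm (l # w) k = word_perm w (transpose (letter_index l) (letter_index l + 1) k)"

text \<open>The signed contribution of one crossing to the entry of the strands currently at positions
  \<open>a\<close> and \<open>b\<close>, counted only if the strand at \<open>a\<close> is the upper one.\<close>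

fun letter_crossing :: "braid_letter \<Rightarrow> nat \<Rightarrow> nat \<Rightarrow> int" where
  "letter_crossing (Pos s) a b = (if a = s \<and> b = s + 1 then 1 else 0)"
| "letter_crossing (Neg s) a b = (if a = s + 1 \<and> b = s then - 1 else 0)"

fun word_crossing :: "braid_word \<Rightarrow> nat \<Rightarrow> nat \<Rightarrow> int" where
  "word_crossing [] a b = 0"
| "word_crossing (l # w) a b = letter_crossing l a b +
    word_crossing w (transpose (letter_index l) (letter_index l + 1) a)
      (transpose (letter_index l) (letter_index l + 1) b)"

definition word_crossing_matrix :: "nat \<Rightarrow> braid_word \<Rightarrow> int mat" where
  "word_crossing_matrix m w =
    mat m m (\<lambda>(i, j). if i = j then 0 else word_crossing w (i + 1) (j + 1))"

text \<open>Functions of a braid are the common value of a function of its words; that this value is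
  the same for all words of a braid is shown below.\<close>

definition braid_perm :: "braid \<Rightarrow> nat \<Rightarrow> nat" where
  "braid_perm b = the_elem (word_perm ` b)"

definition crossing_matrix :: "nat \<Rightarrow> braid \<Rightarrow> int mat" where
  "crossing_matrix m b = the_elem (word_crossing_matrix m ` b)"

definition braid_char_poly :: "nat \<Rightarrow> braid \<Rightarrow> int poly" where
  "braid_char_poly m b =
    (let r = group.ord (sym_group m) (braid_perm b)
     in char_poly (crossing_matrix m (b [^]\<^bsub>braid_group m\<^esub> r)))"

definition braid_systems :: "nat \<Rightarrow> nat \<Rightarrow> braid list set" where
  "braid_systems m n = {bs. length bs = n \<and> set bs \<subseteq> carrier (braid_group m)}"

definition system_char_poly :: "nat \<Rightarrow> braid list \<Rightarrow> int poly" where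
  "system_char_poly m bs = (\<Prod>b\<leftarrow>bs. braid_char_poly m b)"

lemma word_perm_append: "word_perm (u @ v) k = word_perm v (word_perm u k)"
  by (induction u arbitrary: k) auto

lemma word_crossing_append:
  "word_crossing (u @ v) a b =
    word_crossing u a b + word_crossing v (word_perm u a) (word_perm u b)"
  by (induction u arbitrary: a b) auto

lemma abs_diff_nat_eq_1: "\<bar>int i - int j\<bar> = 1 \<longleftrightarrow> j = i + 1 \<or> i = j + 1"
  by auto

lemma word_perm_equiv: "braid_equiv m u v \<Longrightarrow> word_perm u = word_perm v"
proof (induction rule: braid_equiv.induct)
  case (append u u' v v')
  then show ?case by (auto simp: fun_eq_iff word_perm_append)
next
  case (braid i j)
  then show ?case by (auto simp: fun_eq_iff abs_diff_nat_eq_1 transpose_def)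
next
  case (commute i j)
  then show ?case by (auto simp: fun_eq_iff transpose_def)
qed (auto simp: fun_eq_iff)

lemma word_crossing_braid:
  "word_crossing [Pos i, Pos (i + 1), Pos i] a b = word_crossing [Pos (i + 1), Pos i, Pos (i + 1)] a b"
proof -
  consider "a = i" | "a = i + 1" | "a = i + 2" | "a \<notin> {i, i + 1, i + 2}" by auto
  moreover consider "b = i" | "b = i + 1" | "b = i + 2" | "b \<notin> {i, i + 1, i + 2}" by auto
  ultimately show ?thesis by cases (cases, simp_all add: transpose_def)+
qed

lemma word_crossing_commute:
  assumes "\<bar>int i - int j\<bar> > 1"
  shows "word_crossing [Pos i, Pos j] a b = word_crossing [Pos j, Pos i] a b"
proof -
  have "i \<noteq> j" "i \<noteq> Suc j" "Suc i \<noteq> j" using assms by auto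
  then have crossing: "letter_crossing (Pos i) (transpose j (j + 1) a) (transpose j (j + 1) b)
      = letter_crossing (Pos i) a b"
    "letter_crossing (Pos j) (transpose i (i + 1) a) (transpose i (i + 1) b)
      = letter_crossing (Pos j) a b"
    by (simp_all add: transpose_def)
  then show ?thesis by simp
qed

lemma word_crossing_equiv: "braid_equiv m u v \<Longrightarrow> word_crossing u = word_crossing v"
proof (induction rule: braid_equiv.induct)
  case (append u u' v v')
  then show ?case by (simp add: fun_eq_iff word_crossing_append word_perm_equiv[OF append.hyps(1)])
next
  case (braid i j)
  then show ?case
    using word_crossing_braid[of i] word_crossing_braid[of j]
    by (auto simp only: fun_eq_iff abs_diff_nat_eq_1)
next
  case (commute i j)
  then show ?case using word_crossing_commute by blast
next
  case (Pos_Neg i)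
  show ?case by (simp add: fun_eq_iff transpose_def)
next
  case (Neg_Pos i)
  show ?case by (simp add: fun_eq_iff transpose_def)
qed simp_all

lemma the_elem_braid_class:
  assumes "w \<in> braid_words m" "\<And>v. braid_equiv m w v \<Longrightarrow> f v = f w"
  shows "the_elem (f ` (braid_rel m `` {w})) = f w"
  by (rule the_elem_image_unique)
    (use assms in \<open>auto simp: braid_rel_def intro: braid_equiv.refl\<close>)

lemma braid_perm_class:
  "w \<in> braid_words m \<Longrightarrow> braid_perm (braid_rel m `` {w}) = word_perm w"
  unfolding braid_perm_def by (rule the_elem_braid_class) (auto dest: word_perm_equiv)

lemma crossing_matrix_class:
  "w \<in> braid_words m \<Longrightarrow> crossing_matrix m (braid_rel m `` {w}) = word_crossing_matrix m w"
  unfolding crossing_matrix_def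
  by (rule the_elem_braid_class, assumption, drule word_crossing_equiv)
    (simp only: word_crossing_matrix_def)

lemma word_perm_permutes: "w \<in> braid_words m \<Longrightarrow> word_perm w permutes {1..m}"
proof (induction w)
  case Nil
  have "word_perm [] = id" by auto
  then show ?case by (simp only: permutes_id)
next
  case (Cons l w)
  have "transpose (letter_index l) (letter_index l + 1) permutes {1..m}"
    using Cons.prems by (intro permutes_swap_id) auto
  moreover have "word_perm (l # w) =
      word_perm w \<circ> transpose (letter_index l) (letter_index l + 1)"
    by auto
  moreover have "word_perm w permutes {1..m}" using Cons by simp
  ultimately show ?case by (simp only: permutes_compose)
qed

definition conj_right :: "('a, 'b) monoid_scheme \<Rightarrow> 'a \<Rightarrow> 'a \<Rightarrow> 'a" where
  "conj_right G g h = inv\<^bsub>G\<^esub> h \<otimes>\<^bsub>G\<^esub> g \<otimes>\<^bsub>G\<^esub> h"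

text \<open>The entry $g_i$ of a tuple is the list element \<open>gs ! (i - 1)\<close>.\<close>

fun hurwitz_letter :: "('a, 'b) monoid_scheme \<Rightarrow> 'a list \<Rightarrow> braid_letter \<Rightarrow> 'a list" where
  "hurwitz_letter G gs (Pos i) =
    gs[i - 1 := gs ! i, i := conj_right G (gs ! (i - 1)) (gs ! i)]"
| "hurwitz_letter G gs (Neg i) =
    gs[i - 1 := conj_right G (gs ! i) (inv\<^bsub>G\<^esub> (gs ! (i - 1))), i := gs ! (i - 1)]"

definition hurwitz_action :: "('a, 'b) monoid_scheme \<Rightarrow> 'a list \<Rightarrow> braid \<Rightarrow> 'a list" where
  "hurwitz_action G gs \<beta> = the_elem (foldl (hurwitz_letter G) gs ` \<beta>)"

definition hurwitz_equivalent :: "('a, 'b) monoid_scheme \<Rightarrow> nat \<Rightarrow> 'a list \<Rightarrow> 'a list \<Rightarrow> bool" where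
  "hurwitz_equivalent G n gs hs \<longleftrightarrow>
    (\<exists>\<beta>\<in>carrier (braid_group n). hs = hurwitz_action G gs \<beta>)"

context group
begin

lemma conj_right_closed:
  "g \<in> carrier G \<Longrightarrow> h \<in> carrier G \<Longrightarrow> conj_right G g h \<in> carrier G"
  by (simp add: conj_right_def)

lemma length_hurwitz_letter: "length (hurwitz_letter G gs l) = length gs"
  by (cases l) auto

lemma hurwitz_letter_closed:
  assumes "set gs \<subseteq> carrier G" "letter_index l \<in> {1..<length gs}"
  shows "set (hurwitz_letter G gs l) \<subseteq> carrier G"
proof (cases l)
  case (Pos i)
  then have "gs ! i \<in> carrier G" "gs ! (i - 1) \<in> carrier G"
    using assms nth_mem[of i gs] nth_mem[of "i - 1" gs] by auto
  then show ?thesis using Pos assms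
    by (auto dest!: subsetD[OF set_update_subset_insert] intro: conj_right_closed)
next
  case (Neg i)
  then have "gs ! i \<in> carrier G" "gs ! (i - 1) \<in> carrier G"
    using assms nth_mem[of i gs] nth_mem[of "i - 1" gs] by auto
  then show ?thesis using Neg assms
    by (auto dest!: subsetD[OF set_update_subset_insert] intro: conj_right_closed)
qed

lemma hurwitz_word_closed:
  assumes "set gs \<subseteq> carrier G" "w \<in> braid_words (length gs)"
  shows "set (foldl (hurwitz_letter G) gs w) \<subseteq> carrier G
    \<and> length (foldl (hurwitz_letter G) gs w) = length gs"
  using assms
proof (induction w arbitrary: gs)
  case (Cons l w)
  then show ?case
    using Cons.IH[of "hurwitz_letter G gs l"]
    by (simp add: hurwitz_letter_closed length_hurwitz_letter)
qed simp

lemma conj_right_inv: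
  assumes "g \<in> carrier G" "h \<in> carrier G"
  shows "conj_right G (conj_right G g h) (inv h) = g" "conj_right G (conj_right G g (inv h)) h = g"
proof -
  have cancel: "h \<otimes> (inv h \<otimes> x) = x" "inv h \<otimes> (h \<otimes> x) = x" if "x \<in> carrier G" for x
    using that assms by (simp_all flip: m_assoc)
  show "conj_right G (conj_right G g h) (inv h) = g" "conj_right G (conj_right G g (inv h)) h = g"
    using assms by (simp_all add: conj_right_def m_assoc cancel)
qed

lemma conj_right_distrib:
  assumes "f \<in> carrier G" "g \<in> carrier G" "h \<in> carrier G"
  shows "conj_right G (conj_right G f g) h
    = conj_right G (conj_right G f h) (conj_right G g h)"
proof -
  have cancel: "h \<otimes> (inv h \<otimes> x) = x" "g \<otimes> (inv g \<otimes> x) = x" if "x \<in> carrier G" for x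
    using that assms by (simp_all flip: m_assoc)
  show ?thesis
    using assms by (simp add: conj_right_def m_assoc inv_mult_group cancel)
qed

lemma hurwitz_word_equiv:
  assumes "braid_equiv n u v" "length gs = n" "set gs \<subseteq> carrier G"
  shows "foldl (hurwitz_letter G) gs u = foldl (hurwitz_letter G) gs v"
  using assms
proof (induction arbitrary: gs rule: braid_equiv.induct)
  case (sym u v)
  then show ?case by metis
next
  case (trans u v w)
  then show ?case by metis
next
  case (append u u' v v')
  have "u' \<in> braid_words n" using append.hyps(1) braid_equiv_words by blast
  then have "set (foldl (hurwitz_letter G) gs u') \<subseteq> carrier G"
    "length (foldl (hurwitz_letter G) gs u') = n"
    using hurwitz_word_closed append.prems by auto
  then show ?case using append by simp
next
  case (Pos_Neg i)
  then have "gs ! i \<in> carrier G" "gs ! (i - 1) \<in> carrier G"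
    using nth_mem[of i gs] nth_mem[of "i - 1" gs] by auto
  then show ?case using Pos_Neg
    by (auto intro!: nth_equalityI simp: nth_list_update conj_right_inv)
next
  case (Neg_Pos i)
  then have "gs ! i \<in> carrier G" "gs ! (i - 1) \<in> carrier G"
    using nth_mem[of i gs] nth_mem[of "i - 1" gs] by auto
  then show ?case using Neg_Pos
    by (auto intro!: nth_equalityI simp: nth_list_update conj_right_inv)
next
  case (braid i j)
  have step: "foldl (hurwitz_letter G) gs [Pos k, Pos (k + 1), Pos k]
    = foldl (hurwitz_letter G) gs [Pos (k + 1), Pos k, Pos (k + 1)]"
    if "k \<ge> 1" "k + 1 < n" for k
  proof -
    have "gs ! k \<in> carrier G" "gs ! (k - 1) \<in> carrier G" "gs ! (k + 1) \<in> carrier G"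
      using that braid.prems nth_mem[of k gs] nth_mem[of "k - 1" gs] nth_mem[of "k + 1" gs] by auto
    then show ?thesis using that braid.prems
      by (auto intro!: nth_equalityI simp: nth_list_update conj_right_distrib[symmetric])
  qed
  then show ?case
    using braid step[of i] step[of j] by (auto simp: abs_diff_nat_eq_1)
next
  case (commute i j)
  then have "i - 1 \<noteq> j" "i \<noteq> j - 1" "i \<noteq> j" "i - 1 \<noteq> j - 1" by auto
  then show ?case using commute
    by (auto intro!: nth_equalityI simp: nth_list_update)
qed simp

lemma hurwitz_action_class:
  assumes "w \<in> braid_words (length gs)" "set gs \<subseteq> carrier G"
  shows "hurwitz_action G gs (braid_rel (length gs) `` {w}) = foldl (hurwitz_letter G) gs w"
  unfolding hurwitz_action_def
  by (rule the_elem_braid_class[OF assms(1)])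
    (rule hurwitz_word_equiv[OF _ HOL.refl assms(2), symmetric])

end

end

theory Submission
  imports Defs
begin

text \<open>
  A Hurwitz move interchanges two adjacent entries of a tuple and replaces one of them by a
  conjugate. The multiset of values of a class function on the entries of a tuple is therefore a
  Hurwitz invariant (lemma \<open>mset_map_hurwitz_word\<close>), and since \<^term>\<open>system_char_poly\<close> is a product
  over the entries, it suffices that \<^term>\<open>braid_char_poly\<close> is a class function
  (lemma \<open>braid_char_poly_conj_right\<close>).

  For this, let $r$ be the order of the braid permutation of $g$. Then $g^r$ is a pure braid, and
  $r$ is the least positive exponent with this property. As conjugates of pure braids are pure and
  $(h^{-1}gh)^k = h^{-1}g^kh$, the conjugate $h^{-1}gh$ has the same $r$. It remains to compare the
  crossing matrices of a pure braid $p$ and of $h^{-1}ph$. Crossing matrices satisfy the cocycle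
  rule $C(bc)_{ij} = C(b)_{ij} + C(c)_{\pi(i)\pi(j)}$, where $\pi$ is the permutation of $b$. In
  $h^{-1}ph$ the strands enter $h$ in the same order in which they leave $h^{-1}$, because $p$ is
  pure; so the contributions of $h^{-1}$ and $h$ add up to $C(h^{-1}h) = 0$, and what is left is
  $C(p)$ with rows and columns permuted simultaneously by the permutation of $h^{-1}$. Such a
  permutation of rows and columns preserves the characteristic polynomial.
\<close>

section \<open>Class functions and the Hurwitz action\<close>

lemma (in group) nat_pow_conj_right:
  assumes "g \<in> carrier G" "h \<in> carrier G"
  shows "conj_right G g h [^] (k::nat) = conj_right G (g [^] k) h"
proof (induction k)
  case 0
  show ?case using assms by (simp add: conj_right_def)
next
  case (Suc k)
  have "h \<otimes> (inv h \<otimes> x) = x" if "x \<in> carrier G" for x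
    using that assms by (simp flip: m_assoc)
  then show ?case using Suc assms by (simp add: conj_right_def m_assoc)
qed

text \<open>Seen through a class function, a Hurwitz move is a mere transposition of two entries.\<close>

lemma (in group) mset_map_hurwitz_letter:
  assumes class_fun: "\<And>g h. g \<in> carrier G \<Longrightarrow> h \<in> carrier G \<Longrightarrow> f (conj_right G g h) = f g"
    and gs: "set gs \<subseteq> carrier G" "letter_index l \<in> {1..<length gs}"
  shows "mset (map f (hurwitz_letter G gs l)) = mset (map f gs)"
proof -
  define i where "i = letter_index l"
  have i: "i - 1 < length gs" "i < length gs" using gs(2) by (auto simp: i_def)
  then have "gs ! i \<in> carrier G" "gs ! (i - 1) \<in> carrier G"
    using gs(1) nth_mem by blast+
  then have "map f (hurwitz_letter G gs l)
      = (map f gs)[i - 1 := map f gs ! i, i := map f gs ! (i - 1)]"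
    using i by (cases l) (simp_all add: map_update class_fun i_def)
  then show ?thesis
    using i mset_swap[of i "map f gs" "i - 1"] by (simp del: mset_map)
qed

lemma (in group) mset_map_hurwitz_word:
  assumes class_fun: "\<And>g h. g \<in> carrier G \<Longrightarrow> h \<in> carrier G \<Longrightarrow> f (conj_right G g h) = f g"
    and "set gs \<subseteq> carrier G" "w \<in> braid_words (length gs)"
  shows "mset (map f (foldl (hurwitz_letter G) gs w)) = mset (map f gs)"
  using assms(2,3)
proof (induction w arbitrary: gs)
  case (Cons l w)
  then show ?case
    using Cons.IH[of "hurwitz_letter G gs l"] mset_map_hurwitz_letter[OF class_fun, of gs l]
    by (simp add: hurwitz_letter_closed length_hurwitz_letter)
qed simp

lemma (in group) mset_map_hurwitz_equivalent:
  assumes class_fun: "\<And>g h. g \<in> carrier G \<Longrightarrow> h \<in> carrier G \<Longrightarrow> f (conj_right G g h) = f g"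
    and "set gs \<subseteq> carrier G" "hurwitz_equivalent G (length gs) gs hs"
  shows "mset (map f hs) = mset (map f gs)"
proof -
  obtain \<beta> where \<beta>: "\<beta> \<in> carrier (braid_group (length gs))" "hs = hurwitz_action G gs \<beta>"
    using assms(3) by (auto simp: hurwitz_equivalent_def)
  obtain w where "w \<in> braid_words (length gs)" "\<beta> = braid_rel (length gs) `` {w}"
    using \<beta>(1) by (rule carrier_braid_groupE)
  then show ?thesis
    using \<beta>(2) assms(2) by (simp add: hurwitz_action_class mset_map_hurwitz_word[OF class_fun] del: mset_map)
qed

section \<open>Simultaneous permutation of rows and columns\<close>

lemma det_permute_rows_columns:
  fixes A :: "'a :: comm_ring_1 mat"
  assumes A: "A \<in> carrier_mat n n" and p: "p permutes {0..<n}"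
  shows "det (mat n n (\<lambda>(i, j). A $$ (p i, p j))) = det A"
proof -
  define B where "B = mat n n (\<lambda>(i, j). A $$ (p i, j))"
  define B' where "B' = mat n n (\<lambda>(i, j). B\<^sup>T $$ (p i, j))"
  have p_less: "p i < n" if "i < n" for i
    using permutes_in_image[OF p, of i] that by simp
  have B: "B \<in> carrier_mat n n" and B': "B' \<in> carrier_mat n n"
    by (simp_all add: B_def B'_def)
  have "mat n n (\<lambda>(i, j). A $$ (p i, p j)) = B'\<^sup>T"
    by (rule eq_matI) (auto simp: B_def B'_def p_less)
  then have "det (mat n n (\<lambda>(i, j). A $$ (p i, p j))) = det B'"
    by (simp add: det_transpose[OF B'])
  also have "\<dots> = signof p * det (B\<^sup>T)"
    unfolding B'_def using B by (intro det_permute_rows p) simp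
  also have "det (B\<^sup>T) = det B" by (rule det_transpose[OF B])
  also have "det B = signof p * det A"
    unfolding B_def by (rule det_permute_rows[OF A p])
  also have "signof p * (signof p * det A) = det A"
    by (simp add: sign_def)
  finally show ?thesis .
qed

text \<open>Rows and columns are permuted by the same \<open>p\<close>, so diagonal entries stay on the diagonal and the
  permutation commutes with forming $xI - A$.\<close>

lemma char_poly_permute_rows_columns:
  fixes A :: "'a :: comm_ring_1 mat"
  assumes A: "A \<in> carrier_mat n n" and p: "p permutes {0..<n}"
  shows "char_poly (mat n n (\<lambda>(i, j). A $$ (p i, p j))) = char_poly A"
proof -
  have p_less: "p i < n" if "i < n" for i
    using permutes_in_image[OF p, of i] that by simp
  have p_inj: "p i = p j \<longleftrightarrow> i = j" for i j
    using permutes_inj[OF p] by (auto dest: injD)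
  have "char_poly_matrix (mat n n (\<lambda>(i, j). A $$ (p i, p j)))
      = mat n n (\<lambda>(i, j). char_poly_matrix A $$ (p i, p j))"
    using A by (intro eq_matI) (auto simp: char_poly_matrix_def p_less p_inj)
  then show ?thesis
    using A unfolding char_poly_def by (simp add: det_permute_rows_columns p)
qed

section \<open>Permutation and crossing matrix of a product of braids\<close>

lemma braid_perm_mult:
  assumes "b \<in> carrier (braid_group m)" "c \<in> carrier (braid_group m)"
  shows "braid_perm (b \<otimes>\<^bsub>braid_group m\<^esub> c) = braid_perm c \<circ> braid_perm b"
  using assms
  by (auto elim!: carrier_braid_groupE
      simp: mult_braid_class braid_perm_class word_perm_append fun_eq_iff)

lemma braid_perm_one: "braid_perm \<one>\<^bsub>braid_group m\<^esub> = id"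
  by (simp add: one_braid_group braid_perm_class fun_eq_iff)

lemma braid_perm_permutes:
  "b \<in> carrier (braid_group m) \<Longrightarrow> braid_perm b permutes {1..m}"
  by (elim carrier_braid_groupE) (simp only: braid_perm_class word_perm_permutes)

lemma word_crossing_same: "word_crossing w a a = 0"
proof (induction w arbitrary: a)
  case (Cons l w)
  then show ?case by (cases l) auto
qed simp

text \<open>A strand never crosses itself, so one formula covers the diagonal and the other entries; this
  makes the cocycle rule below uniform in \<open>i\<close> and \<open>j\<close>.\<close>

lemma word_crossing_matrix_eq:
  "word_crossing_matrix m w = mat m m (\<lambda>(i, j). word_crossing w (i + 1) (j + 1))"
  by (rule eq_matI) (auto simp: word_crossing_matrix_def word_crossing_same)

lemma crossing_matrix_carrier:
  "b \<in> carrier (braid_group m) \<Longrightarrow> crossing_matrix m b \<in> carrier_mat m m"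
  by (auto elim!: carrier_braid_groupE simp: crossing_matrix_class word_crossing_matrix_eq)

lemma crossing_matrix_one: "crossing_matrix m \<one>\<^bsub>braid_group m\<^esub> = 0\<^sub>m m m"
  by (rule eq_matI) (auto simp: one_braid_group crossing_matrix_class word_crossing_matrix_eq)

text \<open>Matrix indices start at 0, whereas strands are numbered from 1; this is the braid
  permutation acting on matrix indices.\<close>

definition index_perm :: "braid \<Rightarrow> nat \<Rightarrow> nat" where
  "index_perm b i = braid_perm b (i + 1) - 1"

lemma Suc_index_perm:
  assumes "b \<in> carrier (braid_group m)"
  shows "Suc (index_perm b i) = braid_perm b (Suc i)"
proof -
  \<comment> \<open>The permutation fixes 0, so the truncated subtraction in the definition of the index
    permutation loses nothing.\<close>
  have "braid_perm b (Suc i) \<noteq> 0"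
    using permutes_inj[OF braid_perm_permutes[OF assms]]
      permutes_not_in[OF braid_perm_permutes[OF assms], of 0]
    by (metis atLeastAtMost_iff injD nat.distinct(1) not_one_le_zero)
  then show ?thesis by (simp add: index_perm_def)
qed

lemma index_perm_permutes:
  assumes "b \<in> carrier (braid_group m)"
  shows "index_perm b permutes {0..<m}"
proof (rule bij_imp_permutes)
  note perm = braid_perm_permutes[OF assms]
  have "inj_on (index_perm b) {0..<m}"
    by (rule inj_onI)
      (metis Suc_index_perm[OF assms] Suc_inject permutes_inj[OF perm] injD)
  moreover have "index_perm b i < m" if "i < m" for i
    using permutes_in_image[OF perm, of "Suc i"] that
    by (simp flip: Suc_index_perm[OF assms])
  then have "index_perm b ` {0..<m} \<subseteq> {0..<m}" by auto
  ultimately show "bij_betw (index_perm b) {0..<m} {0..<m}"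
    by (simp add: bij_betw_def endo_inj_surj)
  show "index_perm b i = i" if "i \<notin> {0..<m}" for i
    using permutes_not_in[OF perm, of "Suc i"] that by (simp add: index_perm_def)
qed

lemma index_perm_less:
  "b \<in> carrier (braid_group m) \<Longrightarrow> i < m \<Longrightarrow> index_perm b i < m"
  using permutes_in_image[OF index_perm_permutes, of b m i] by simp

lemma index_perm_mult:
  assumes "b \<in> carrier (braid_group m)" "c \<in> carrier (braid_group m)"
  shows "index_perm (b \<otimes>\<^bsub>braid_group m\<^esub> c) i = index_perm c (index_perm b i)"
  using assms by (simp add: index_perm_def[of "b \<otimes>\<^bsub>braid_group m\<^esub> c"] braid_perm_mult
      flip: Suc_index_perm)

text \<open>The cocycle rule: strand \<open>i\<close> of \<open>b \<otimes> c\<close> runs along strand \<open>i\<close> of \<open>b\<close> and then along the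
  strand of \<open>c\<close> that starts where the former ends.\<close>

lemma crossing_matrix_mult:
  assumes "b \<in> carrier (braid_group m)" "c \<in> carrier (braid_group m)" "i < m" "j < m"
  shows "crossing_matrix m (b \<otimes>\<^bsub>braid_group m\<^esub> c) $$ (i, j)
    = crossing_matrix m b $$ (i, j)
      + crossing_matrix m c $$ (index_perm b i, index_perm b j)"
proof -
  obtain u v where u: "u \<in> braid_words m" "b = braid_rel m `` {u}"
    and v: "v \<in> braid_words m" "c = braid_rel m `` {v}"
    using assms(1,2) by (metis carrier_braid_groupE)
  have "Suc (index_perm b k) = word_perm u (Suc k)" for k
    unfolding Suc_index_perm[OF assms(1)] using u by (simp add: braid_perm_class)
  then show ?thesis
    using u v assms(3,4) index_perm_less[OF assms(1)]
    by (simp add: mult_braid_class crossing_matrix_class word_crossing_matrix_eq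
        word_crossing_append)
qed

section \<open>Conjugation of braids\<close>

text \<open>Purity of \<open>p\<close> enters here: \<open>p\<close> does not change the order in which the strands enter \<open>h\<close>, so
  that the contributions of \<open>inv h\<close> and \<open>h\<close> cancel.\<close>

lemma crossing_matrix_conj_right:
  fixes m :: nat
  defines "G \<equiv> braid_group m"
  assumes p: "p \<in> carrier G" "braid_perm p = id" and h: "h \<in> carrier G"
  shows "crossing_matrix m (conj_right G p h)
    = mat m m (\<lambda>(i, j). crossing_matrix m p $$ (index_perm (inv\<^bsub>G\<^esub> h) i, index_perm (inv\<^bsub>G\<^esub> h) j))"
proof (rule eq_matI)
  interpret group G unfolding G_def by (rule group_braid_group)
  let ?h' = "inv\<^bsub>G\<^esub> h"
  have h': "?h' \<in> carrier G" using h by simp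
  have pure: "index_perm p i = i" for i using p(2) by (simp add: index_perm_def)
  note mult = crossing_matrix_mult[of _ m, folded G_def]
  note less = index_perm_less[of _ m, folded G_def]
  fix i j
  assume "i < dim_row (mat m m (\<lambda>(i, j).
      crossing_matrix m p $$ (index_perm ?h' i, index_perm ?h' j)))"
    and "j < dim_col (mat m m (\<lambda>(i, j).
      crossing_matrix m p $$ (index_perm ?h' i, index_perm ?h' j)))"
  then have ij: "i < m" "j < m" by simp_all
  have "crossing_matrix m ?h' $$ (i, j)
      + crossing_matrix m h $$ (index_perm ?h' i, index_perm ?h' j) = 0"
    using mult[OF h' h ij] crossing_matrix_one[of m, folded G_def] h ij by simp
  then show "crossing_matrix m (conj_right G p h) $$ (i, j)
      = mat m m (\<lambda>(i, j). crossing_matrix m p $$ (index_perm ?h' i, index_perm ?h' j)) $$ (i, j)"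
    using ij p(1) h h' less[OF h']
    by (simp add: conj_right_def mult index_perm_mult[of _ m, folded G_def] pure)
next
  interpret group G unfolding G_def by (rule group_braid_group)
  have "crossing_matrix m (conj_right G p h) \<in> carrier_mat m m"
    using p h conj_right_closed crossing_matrix_carrier unfolding G_def by blast
  then show "dim_row (crossing_matrix m (conj_right G p h)) = dim_row (mat m m (\<lambda>(i, j).
      crossing_matrix m p $$ (index_perm (inv\<^bsub>G\<^esub> h) i, index_perm (inv\<^bsub>G\<^esub> h) j)))"
    and "dim_col (crossing_matrix m (conj_right G p h)) = dim_col (mat m m (\<lambda>(i, j).
      crossing_matrix m p $$ (index_perm (inv\<^bsub>G\<^esub> h) i, index_perm (inv\<^bsub>G\<^esub> h) j)))"
    by auto
qed

lemma braid_perm_nat_pow: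
  assumes "b \<in> carrier (braid_group m)"
  shows "braid_perm (b [^]\<^bsub>braid_group m\<^esub> (k::nat)) = braid_perm b [^]\<^bsub>sym_group m\<^esub> k"
proof (induction k)
  case 0
  show ?case by (simp add: braid_perm_one sym_group_def)
next
  case (Suc k)
  interpret B: group "braid_group m" by (rule group_braid_group)
  interpret S: group "sym_group m" by (rule sym_group_is_group)
  have "braid_perm b \<in> carrier (sym_group m)"
    using braid_perm_permutes[OF assms] by (simp add: sym_group_def)
  then have "braid_perm b [^]\<^bsub>sym_group m\<^esub> Suc k
      = braid_perm b \<circ> braid_perm b [^]\<^bsub>sym_group m\<^esub> k"
    by (subst S.nat_pow_Suc2) (simp_all add: sym_group_def)
  then show ?case using Suc assms by (simp add: braid_perm_mult)
qed

text \<open>The order is determined by its multiples, which are the exponents of the pure powers of \<open>b\<close>.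
  Invariance of the order under conjugation thus reduces to invariance of purity.\<close>

lemma ord_braid_perm_dvd_iff:
  assumes "b \<in> carrier (braid_group m)"
  shows "group.ord (sym_group m) (braid_perm b) dvd k
    \<longleftrightarrow> braid_perm (b [^]\<^bsub>braid_group m\<^esub> k) = id"
proof -
  interpret S: group "sym_group m" by (rule sym_group_is_group)
  have "braid_perm b \<in> carrier (sym_group m)"
    using braid_perm_permutes[OF assms] by (simp add: sym_group_def)
  then show ?thesis
    using S.pow_eq_id[of "braid_perm b" k] assms
    by (simp add: braid_perm_nat_pow sym_group_def)
qed

lemma braid_perm_conj_right_eq_id_iff:
  fixes m :: nat
  defines "G \<equiv> braid_group m"
  assumes "p \<in> carrier G" "h \<in> carrier G"
  shows "braid_perm (conj_right G p h) = id \<longleftrightarrow> braid_perm p = id"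
proof -
  interpret group G unfolding G_def by (rule group_braid_group)
  have pure: "braid_perm (conj_right G q c) = id"
    if "q \<in> carrier G" "c \<in> carrier G" "braid_perm q = id" for q c
    using that braid_perm_mult[of "inv\<^bsub>G\<^esub> c" m c, folded G_def] braid_perm_one[of m, folded G_def]
    by (simp add: conj_right_def braid_perm_mult[of _ m, folded G_def])
  show ?thesis
    using pure[of p h] pure[of "conj_right G p h" "inv\<^bsub>G\<^esub> h"] assms(2,3)
    by (auto simp: conj_right_inv conj_right_closed)
qed

lemma ord_braid_perm_conj_right:
  fixes m :: nat
  defines "G \<equiv> braid_group m"
  assumes g: "g \<in> carrier G" and h: "h \<in> carrier G"
  shows "group.ord (sym_group m) (braid_perm (conj_right G g h))
    = group.ord (sym_group m) (braid_perm g)"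
proof -
  interpret group G unfolding G_def by (rule group_braid_group)
  have "group.ord (sym_group m) (braid_perm (conj_right G g h)) dvd k
      \<longleftrightarrow> group.ord (sym_group m) (braid_perm g) dvd k" for k
    using g h by (simp add: ord_braid_perm_dvd_iff[of _ m, folded G_def] conj_right_closed
        nat_pow_conj_right braid_perm_conj_right_eq_id_iff[of _ m, folded G_def])
  then show ?thesis by (meson dvd_antisym dvd_refl)
qed

lemma braid_char_poly_conj_right:
  fixes m :: nat
  defines "G \<equiv> braid_group m"
  assumes g: "g \<in> carrier G" and h: "h \<in> carrier G"
  shows "braid_char_poly m (conj_right G g h) = braid_char_poly m g"
proof -
  interpret group G unfolding G_def by (rule group_braid_group)
  define r where "r = group.ord (sym_group m) (braid_perm g)"
  define p where "p = g [^]\<^bsub>G\<^esub> r"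
  have p: "p \<in> carrier G" using g by (simp add: p_def)
  have pure: "braid_perm p = id"
    using ord_braid_perm_dvd_iff[of g m r, folded G_def] g by (simp add: p_def r_def)
  have "braid_char_poly m (conj_right G g h) = char_poly (crossing_matrix m (conj_right G p h))"
    using ord_braid_perm_conj_right[of g m h, folded G_def] g h
    by (simp add: braid_char_poly_def nat_pow_conj_right p_def r_def flip: G_def)
  also have "\<dots> = char_poly (crossing_matrix m p)"
    using p h pure
    by (simp add: crossing_matrix_conj_right[of _ m, folded G_def] char_poly_permute_rows_columns
        crossing_matrix_carrier[of _ m, folded G_def] index_perm_permutes[of _ m, folded G_def])
  also have "\<dots> = braid_char_poly m g"
    by (simp add: braid_char_poly_def p_def r_def flip: G_def)
  finally show ?thesis .
qed

section \<open>Hurwitz invariance\<close>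

theorem theorem1:
  fixes m n :: nat and bs bs' :: "braid list"
  assumes "m \<ge> 2" and "n \<ge> 1"
    and "bs \<in> braid_systems m n" and "bs' \<in> braid_systems m n"
    and "hurwitz_equivalent (braid_group m) n bs bs'"
  shows "system_char_poly m bs = system_char_poly m bs'"
proof -
  interpret group "braid_group m" by (rule group_braid_group)
  have "mset (map (braid_char_poly m) bs') = mset (map (braid_char_poly m) bs)"
    using assms(3,5)
    by (intro mset_map_hurwitz_equivalent braid_char_poly_conj_right)
      (auto simp: braid_systems_def)
  then show ?thesis
    unfolding system_char_poly_def by (metis prod_mset_prod_list)
qed

end
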